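(* Let $Q,K_0,K_1$ be positive integers, let $p_A,p_B\in[0,1]$ with neither $p_A=p_B=0$ nor $p_A=p_B=1$, and let $q_A=1-p_A$, $q_B=1-p_B$. For a Best-of-$L$-Sets match with $L=2Q+1$ and with set tie-breaker parameters $(K_0,K_1)$, in which player $A$ serves first, the probability $\theta_M(p_A,p_B,K_0,K_1,Q)$ that $A$ wins the match is $$\theta_M(p_A,p_B,K_0,K_1,Q)=\sum_{h=0}^{Q-1}\theta_M(Q+1,h,p_A,p_B,K_0,K_1,Q)+\theta_M(Q+1,Q,p_A,p_B,K_0,K_1,Q),$$ where $\theta_M(Q+1,h,p_A,p_B,K_0,K_1,Q)$ is the probability that the final match score is $(Q+1,h)$, and, for $h\in\{0,1,\ldots,Q-1\}$, $$\theta_M(Q+1,h,p_A,p_B,K_0,K_1,Q)=\Big\{\sum_{j=0}^Q\binom{t_A(Q+h)}{j}\binom{t_B(Q+h)}{Q-j}[\theta_S(p_A,p_B,K_0)]^j[1-\theta_S(p_A,p_B,K_0)]^{t_A(Q+h)-j}$$ $$\qquad\times[1-\theta_S(p_B,p_A,K_0)]^{Q-j}[\theta_S(p_B,p_A,K_0)]^{t_B(Q+h)-(Q-j)}\Big\}\,[\theta_S(p_A,p_B,K_0)]^{J_A(Q+1+h)}[1-\theta_S(p_B,p_A,K_0)]^{1-J_A(Q+1+h)},$$ and $$\theta_M(Q+1,Q,p_A,p_B,K_0,K_1,Q)=\Big\{\sum_{j=0}^Q\binom{Q}{j}^2[\theta_S(p_A,p_B,K_0)\theta_S(p_B,p_A,K_0)]^j[(1-\theta_S(p_A,p_B,K_0))(1-\theta_S(p_B,p_A,K_0))]^{Q-j}\Big\}$$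 $$\qquad\times[\theta_S(p_A,p_B,K_1)]^{J_A(2Q+1)}[1-\theta_S(p_B,p_A,K_1)]^{1-J_A(2Q+1)}.$$ Alternatively, writing $\theta_M(p_A,p_B,K,Q)$ with a single set tie-breaker parameter $K$ (that is, $K_0=K_1=K$), $$\theta_M(p_A,p_B,K,Q)=\Pr\{B(2Q,\theta_S(p_A,p_B,K))+B(2Q,1-\theta_S(p_B,p_A,K))\ge Q\}$$ $$\qquad+\Pr\{B(2Q,\theta_S(p_A,p_B,K))+B(2Q,1-\theta_S(p_B,p_A,K))\ge Q\}\,\theta_S(p_A,p_B,K),$$ where the two binomial random variables in each probability are independent. In addition, $\theta_M(p_A,p_B,K_0,K_1,Q)=\theta_M(q_B,q_A,K_0,K_1,Q)$.
   Context: Players $A$ and $B$ play points; all point outcomes are independent. When $A$ serves a point, $A$ wins it with probability $p_A$ (and $B$ wins it otherwise); when $B$ serves a point, $B$ wins it with probability $p_B$ (and $A$ wins it otherwise). Game: one player serves all points; the game is won by the first player with at least 4 points and an advantage of at least 2 points. $K$-point set tie-breaker: the first server $X$ and the other player $Y$ serve points in the sequence $XYYXXYYXX\ldots$; the first player to reach at least $K$ points with an advantage of at least two points wins (from a score of $K-1$ points each, play continues with the same serving sequence until one player is ahead by two). Set with a $K$-point set tie-breaker: the players alternate serving games. A player who first reaches 6 won games with an advantage of at least 2 games wins the set. If the score is 5 games each, a player who reaches 7 games while the opponent remains at 5 wins; if the score becomes 6 games each, the $K$-point set tie-breaker is played, with first server the player who received in the last game, and its winner wins the set. $\theta_S(x,y,K)$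 is the probability that the first server in the set wins the set, when the first server wins own-serve points with probability $x$ and the other player wins own-serve points with probability $y$. Match (Best-of-$L$-Sets, $L=2Q+1$): sets are played until a player has won $Q+1$ sets; that player wins the match. The first $L-1$ sets use $K_0$-point set tie-breakers, and the $L$th set (if played) uses a $K_1$-point set tie-breaker. Player $A$ serves first in the first set. In each succeeding set, the first server is the player who received in the last game of the previous set if that set had no set tie-breaker, and is the player who received first in the set tie-breaker if there was one. A match score $(a,b)$ means $A$ has won $a$ sets and $B$ has won $b$ sets. $\theta_M(x,y,K_0,K_1,Q)$ is the probability that the first server of the match wins it when the first server wins own-serve points with probability $x$ and the other player with probability $y$; $\theta_M(x,y,K,Q)$ denotes the same probability with a single set tie-breaker parameter $K$. $t_A(g)=\lfloor (g+1)/2\rfloor$, $t_B(g)=g-t_A(g)$, $J_A(g)=g\bmod 2$. $B(m,r)$ denotes a binomial random variable with $m$ trials and success probability $r$. Conventions: $0^0=1$; $\binom{m}{k}=0$ if $k>m$, and any summand containing a zero binomial coefficient is $0$.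
   Formalization: The alternative formula is false as printed (p_A=1, p_B=0 gives 2); it is proved as Pr{B(Q,θ_S(p_A,p_B,K))+B(Q,1−θ_S(p_B,p_A,K)) ≥ Q+1} + Pr{the same sum = Q}·θ_S(p_A,p_B,K). *)

theory Defs
  imports "HOL-Probability.Probability"
begin

text \<open>
  Tennis scoring, modelled point by point as probabilistic programs in the monad of discrete
  subprobability distributions.  Every point is a fresh call of \<open>play_point\<close>, which is how the
  independence of the points is expressed.  The programs are least fixed points, so the mass at a
  result is the probability that play stops after finitely many points with that result; the
  missing mass is the probability that play never ends.
\<close>

datatype player = A | B

fun opponent :: "player \<Rightarrow> player" where
  "opponent A = B"
| "opponent B = A"

text \<open>\<open>p z\<close> is the probability that \<open>z\<close> wins a point that \<open>z\<close> serves.\<close>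

type_synonym serve_probs = "player \<Rightarrow> real"

text \<open>Points in a game, games in a set, or sets in a match won so far by each player.\<close>

type_synonym score = "player \<Rightarrow> nat"

definition zero_score :: score where
  "zero_score = (\<lambda>_. 0)"

definition add_win :: "player \<Rightarrow> score \<Rightarrow> score" where
  "add_win w n = n(w := Suc (n w))"

definition ahead_by_two :: "nat \<Rightarrow> score \<Rightarrow> player \<Rightarrow> bool" where
  "ahead_by_two k n z \<longleftrightarrow> n z \<ge> k \<and> n z \<ge> n (opponent z) + 2"

definition play_point :: "serve_probs \<Rightarrow> player \<Rightarrow> player spmf" where
  "play_point p s =
     map_spmf (\<lambda>b. if b then s else opponent s) (spmf_of_pmf (bernoulli_pmf (p s)))"

text \<open>Winner of a game served by \<open>s\<close>, continued from the point score \<open>n\<close>.\<close>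

partial_function (spmf) game_from :: "serve_probs \<Rightarrow> player \<Rightarrow> score \<Rightarrow> player spmf" where
  "game_from p s n =
     (if ahead_by_two 4 n A then return_spmf A
      else if ahead_by_two 4 n B then return_spmf B
      else bind_spmf (play_point p s) (\<lambda>w. game_from p s (add_win w n)))"

definition play_game :: "serve_probs \<Rightarrow> player \<Rightarrow> player spmf" where
  "play_game p s = game_from p s zero_score"

text \<open>Server of point \<open>i\<close> (counted from 0) when \<open>s\<close> serves first: \<open>s\<close> serves the points
  0, 3, 4, 7, 8, \<dots> and the opponent serves the points 1, 2, 5, 6, \<dots>\<close>

definition tiebreak_server :: "player \<Rightarrow> nat \<Rightarrow> player" where
  "tiebreak_server s i = (if even ((i + 1) div 2) then s else opponent s)"

partial_function (spmf) tiebreak_from ::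
    "serve_probs \<Rightarrow> nat \<Rightarrow> player \<Rightarrow> score \<Rightarrow> player spmf" where
  "tiebreak_from p K s n =
     (if ahead_by_two K n A then return_spmf A
      else if ahead_by_two K n B then return_spmf B
      else bind_spmf (play_point p (tiebreak_server s (n A + n B)))
             (\<lambda>w. tiebreak_from p K s (add_win w n)))"

definition play_tiebreak :: "serve_probs \<Rightarrow> nat \<Rightarrow> player \<Rightarrow> player spmf" where
  "play_tiebreak p K s = tiebreak_from p K s zero_score"

text \<open>
  Remainder of a set from the game score \<open>g\<close>, where \<open>s\<close> is the player due to serve next, that is,
  the receiver of the last game.  The result is the winner of the set together with the first
  server of the following set: the receiver of the last game if there was no tie-breaker, and the
  player who received first in the tie-breaker otherwise.  The test at 6 games with a lead of 2
  also covers the score 7-5, since 6-6 is caught before it.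
\<close>

partial_function (spmf) set_from ::
    "serve_probs \<Rightarrow> nat \<Rightarrow> player \<Rightarrow> score \<Rightarrow> (player \<times> player) spmf" where
  "set_from p K s g =
     (if g A = 6 \<and> g B = 6 then map_spmf (\<lambda>w. (w, opponent s)) (play_tiebreak p K s)
      else if ahead_by_two 6 g A then return_spmf (A, s)
      else if ahead_by_two 6 g B then return_spmf (B, s)
      else bind_spmf (play_game p s) (\<lambda>w. set_from p K (opponent s) (add_win w g)))"

definition play_set :: "serve_probs \<Rightarrow> nat \<Rightarrow> player \<Rightarrow> (player \<times> player) spmf" where
  "play_set p K s = set_from p K s zero_score"

text \<open>Final score of a best-of-\<open>2 * Q + 1\<close>-sets match, continued from the set score \<open>m\<close> with \<open>s\<close>
  serving first in the next set.  Only the last possible set uses \<open>K1\<close>.\<close>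

partial_function (spmf) match_from ::
    "serve_probs \<Rightarrow> nat \<Rightarrow> nat \<Rightarrow> nat \<Rightarrow> player \<Rightarrow> score \<Rightarrow> score spmf" where
  "match_from p K0 K1 Q s m =
     (if m A = Q + 1 \<or> m B = Q + 1 then return_spmf m
      else bind_spmf (play_set p (if m A + m B = 2 * Q then K1 else K0) s)
             (\<lambda>(w, s'). match_from p K0 K1 Q s' (add_win w m)))"

definition play_match :: "serve_probs \<Rightarrow> nat \<Rightarrow> nat \<Rightarrow> nat \<Rightarrow> player \<Rightarrow> score spmf" where
  "play_match p K0 K1 Q s = match_from p K0 K1 Q s zero_score"

text \<open>In the functions below the first server is called \<open>A\<close> and has parameter \<open>x\<close>, the other
  player is called \<open>B\<close> and has parameter \<open>y\<close>.\<close>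

definition serve_probs_of :: "real \<Rightarrow> real \<Rightarrow> serve_probs" where
  "serve_probs_of x y = case_player x y"

definition theta_S :: "real \<Rightarrow> real \<Rightarrow> nat \<Rightarrow> real" where
  "theta_S x y K =
     measure (measure_spmf (play_set (serve_probs_of x y) K A)) {r. fst r = A}"

definition theta_M :: "real \<Rightarrow> real \<Rightarrow> nat \<Rightarrow> nat \<Rightarrow> nat \<Rightarrow> real" where
  "theta_M x y K0 K1 Q =
     measure (measure_spmf (play_match (serve_probs_of x y) K0 K1 Q A)) {m. m A = Q + 1}"

text \<open>Probability that the final match score is \<open>(a, b)\<close>.\<close>

definition theta_M_score ::
    "nat \<Rightarrow> nat \<Rightarrow> real \<Rightarrow> real \<Rightarrow> nat \<Rightarrow> nat \<Rightarrow> nat \<Rightarrow> real" where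
  "theta_M_score a b x y K0 K1 Q =
     measure (measure_spmf (play_match (serve_probs_of x y) K0 K1 Q A)) {m. m A = a \<and> m B = b}"

definition t_A :: "nat \<Rightarrow> nat" where
  "t_A g = (g + 1) div 2"

definition t_B :: "nat \<Rightarrow> nat" where
  "t_B g = g - t_A g"

definition J_A :: "nat \<Rightarrow> nat" where
  "J_A g = g mod 2"

text \<open>Joint distribution of independent binomial variables \<open>B(m, r)\<close> and \<open>B(n, s)\<close>.\<close>

definition indep_binomials :: "nat \<Rightarrow> real \<Rightarrow> nat \<Rightarrow> real \<Rightarrow> (nat \<times> nat) pmf" where
  "indep_binomials m r n s = pair_pmf (binomial_pmf m r) (binomial_pmf n s)"

end

theory Submission
  imports Defs
begin

text \<open>
  The formulas read as if the sets were served alternately by \<open>A\<close>, \<open>B\<close>, \<open>A\<close>, \<dots>.  In a real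
  match the first server of a set depends on how many games the previous set took, so the servers
  are neither alternating nor independent of the earlier winners.  The formulas are nevertheless
  correct because the winner of a set does not depend on who serves it first: writing \<open>r\<close> for
  \<open>theta_S pA pB K\<close>, the probability \<open>1 - theta_S pB pA K\<close> that \<open>A\<close> wins a set started by \<open>B\<close> is
  again \<open>r\<close>.  The sets of a match are therefore independent trials in which \<open>A\<close> succeeds with
  probability \<open>r\<close>, and every claim becomes a statement about such trials: Vandermonde's identity
  turns the sums into \<open>(Q + h choose h) * r ^ Q * (1 - r) ^ h\<close>, to be multiplied by the probability
  that \<open>A\<close> wins the last set, and playing all \<open>2 * Q + 1\<close> sets, whether or not the match is already
  decided, gives the binomial form.

  Games, tie-breakers and sets are all races to a target with a lead of two.  Cut a race into
  pairs of rounds.  In each pair \<open>A\<close> has success probabilities \<open>a\<close> and \<open>b\<close> in one order or the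
  other (for a game \<open>a = b\<close>), and no race is decided in the first round of a pair in favour of a
  player who would not also be ahead by two after the second.  Hence at the even scores the
  winning probability satisfies a recursion that is symmetric in \<open>a\<close> and \<open>b\<close>
  (\<open>race_value_two_steps\<close>).  Its bounded solution is unique (\<open>race_value_unique\<close>): from a tied
  score close to the target, the difference of two solutions shrinks by the factor
  \<open>a * (1 - b) + (1 - a) * b < 1\<close> with every further pair of rounds, and the lower scores are
  determined by backward induction.  For a set the backward induction starts at 12 games, where it
  is decided or at the tie-breaker (\<open>set_value_unique\<close>).

  Uniqueness is used three times at each level of the scoring.  The probability that \<open>A\<close> wins and
  one minus the probability that \<open>B\<close> wins solve the same recursion, so the race ends almost
  surely.  Interchanging \<open>a\<close> and \<open>b\<close> gives the independence from the first server, and also the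
  last claim of the theorem, since replacing \<open>(pA, pB)\<close> by \<open>(1 - pB, 1 - pA)\<close> interchanges
  \<open>a = pA\<close> and \<open>b = 1 - pB\<close>.  Renaming the players gives \<open>theta_S pB pA K = 1 - theta_S pA pB K\<close>.
  The excluded parameters are those for which \<open>a\<close> and \<open>b\<close> are \<open>0\<close> and \<open>1\<close>, when a tied
  tie-breaker stays tied forever.
\<close>

section \<open>Players and scores\<close>

lemma UNIV_player: "(UNIV :: player set) = {A, B}"
  using player.exhaust by auto

lemma opponent_opponent [simp]: "opponent (opponent s) = s"
  by (cases s) auto

lemma add_win_simps [simp]:
  "add_win A n A = Suc (n A)" "add_win A n B = n B"
  "add_win B n A = n A" "add_win B n B = Suc (n B)"
  by (auto simp: add_win_def)

lemma add_win_commute: "add_win B (add_win A n) = add_win A (add_win B n)"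
  by (auto simp: add_win_def fun_eq_iff)

lemma add_win_opponent: "add_win w n \<circ> opponent = add_win (opponent w) (n \<circ> opponent)"
proof
  fix z show "(add_win w n \<circ> opponent) z = add_win (opponent w) (n \<circ> opponent) z"
    by (cases w; cases z) (auto simp: add_win_def)
qed

lemma integral_spmf_player:
  fixes g :: "player \<Rightarrow> real"
  shows "(\<integral>w. g w \<partial>measure_spmf D) = spmf D A * g A + spmf D B * g B"
proof -
  have fin: "finite (UNIV :: player set)" by (simp add: UNIV_player)
  have "\<bar>g w\<bar> \<le> max \<bar>g A\<bar> \<bar>g B\<bar>" for w by (cases w) auto
  then have "integrable (measure_spmf D) g"
    by (intro measure_spmf.integrable_const_bound[where B = "max \<bar>g A\<bar> \<bar>g B\<bar>"]) auto
  then have "(\<integral>w. g w \<partial>measure_spmf D) = (\<integral>w. spmf D w * g w \<partial>count_space UNIV)"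
    by (rule integral_measure_spmf)
  also have "\<dots> = spmf D A * g A + spmf D B * g B"
    by (subst lebesgue_integral_count_space_finite[OF fin]) (simp add: UNIV_player)
  finally show ?thesis .
qed

lemma spmf_bind_player:
  "spmf (bind_spmf D f) z = spmf D A * spmf (f A) z + spmf D B * spmf (f B) z"
  by (simp add: spmf_bind integral_spmf_player)

section \<open>Races to a target with a lead of two\<close>

abbreviation total :: "score \<Rightarrow> nat" where
  "total n \<equiv> n A + n B"

text \<open>
  \<open>v n\<close> stands for the probability that \<open>A\<close> wins from the score \<open>n\<close>, and \<open>r i\<close> for the probability
  that \<open>A\<close> wins round \<open>i\<close>.  At the scores in \<open>E\<close> the race is broken off and \<open>v\<close> is unconstrained;
  this is how the tie-breaker at 6 games each enters a set.
\<close>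

definition race_value ::
    "nat \<Rightarrow> score set \<Rightarrow> (nat \<Rightarrow> real) \<Rightarrow> (score \<Rightarrow> real) \<Rightarrow> bool" where
  "race_value k E r v \<longleftrightarrow>
     (\<forall>n. ahead_by_two k n A \<longrightarrow> v n = 1) \<and>
     (\<forall>n. ahead_by_two k n B \<longrightarrow> v n = 0) \<and>
     (\<forall>n. n \<notin> E \<longrightarrow> \<not> ahead_by_two k n A \<longrightarrow> \<not> ahead_by_two k n B \<longrightarrow>
        v n = r (total n) * v (add_win A n) + (1 - r (total n)) * v (add_win B n))"

definition paired :: "real \<Rightarrow> real \<Rightarrow> (nat \<Rightarrow> real) \<Rightarrow> bool" where
  "paired a b r \<longleftrightarrow>
     (\<forall>i. even i \<longrightarrow> (r i = a \<and> r (Suc i) = b) \<or> (r i = b \<and> r (Suc i) = a))"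

lemma paired_commute: "paired a b r \<longleftrightarrow> paired b a r"
  by (auto simp: paired_def)

text \<open>
  After renaming the players, \<open>v\<close> and \<open>r\<close> speak of \<open>B\<close>; the complements turn them back into
  quantities about \<open>A\<close>.  The recursion survives because its two weights add up to one.
\<close>

lemma race_value_mirror:
  assumes "race_value k E r v" and "\<And>n. n \<in> E' \<longleftrightarrow> n \<circ> opponent \<in> E"
  shows "race_value k E' (\<lambda>i. 1 - r i) (\<lambda>n. 1 - v (n \<circ> opponent))"
proof -
  have 1: "ahead_by_two k (n \<circ> opponent) z = ahead_by_two k n (opponent z)" for n z
    by (simp add: ahead_by_two_def)
  have 2: "total (n \<circ> opponent) = total n" for n by simp
  show ?thesis
    using assms(1) unfolding race_value_def 1 2 add_win_opponent opponent.simps assms(2)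
  proof (intro conjI allI impI, goal_cases)
    case (3 n)
    then have "v (n \<circ> opponent) = r (total n) * v (add_win A (n \<circ> opponent))
        + (1 - r (total n)) * v (add_win B (n \<circ> opponent))"
      by (metis "1" "2" opponent.simps)
    then show ?case by (simp add: algebra_simps)
  qed (auto simp: 1)
qed

text \<open>
  At an even score that is not yet decided the leads are even, so a player who reaches the target
  with a lead of two in the first round of a pair led by two before and has a lead of at least two
  after the second round as well.  The second round may thus always be played, and after both rounds
  their order no longer matters.
\<close>

lemma race_value_two_steps:
  assumes v: "race_value k E r v" and r: "paired a b r"
    and E: "\<And>m. m \<in> E \<Longrightarrow> even (total m)"
    and n: "even (total n)" "n \<notin> E" "\<not> ahead_by_two k n A" "\<not> ahead_by_two k n B"
  shows "v n = a * b * v (add_win A (add_win A n))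
      + (a * (1 - b) + (1 - a) * b) * v (add_win A (add_win B n))
      + (1 - a) * (1 - b) * v (add_win B (add_win B n))"
proof -
  let ?i = "total n"
  have step: "v m = r (total m) * v (add_win A m) + (1 - r (total m)) * v (add_win B m)"
    if "m \<notin> E" "\<not> ahead_by_two k m A" "\<not> ahead_by_two k m B" for m
    using v that unfolding race_value_def by blast
  have won: "ahead_by_two k m A \<Longrightarrow> v m = 1" "ahead_by_two k m B \<Longrightarrow> v m = 0" for m
    using v unfolding race_value_def by blast+
  have E': "add_win w n \<notin> E" for w
    using E[of "add_win w n"] n(1) by (cases w) auto
  \<comment> \<open>An even total keeps the players from being exactly one point apart.\<close>
  have parity: "n A \<noteq> Suc (n B)" "n B \<noteq> Suc (n A)"
    using n(1) by auto
  have "v n = r ?i * v (add_win A n) + (1 - r ?i) * v (add_win B n)"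
    using step n by blast
  moreover have "v (add_win A n) = r (Suc ?i) * v (add_win A (add_win A n))
      + (1 - r (Suc ?i)) * v (add_win A (add_win B n))"
  proof (cases "ahead_by_two k (add_win A n) A")
    case True
    then have "ahead_by_two k (add_win A (add_win A n)) A" "ahead_by_two k (add_win A (add_win B n)) A"
      using n parity by (auto simp: ahead_by_two_def)
    then show ?thesis using True won by simp
  next
    case False
    then show ?thesis
      using step[of "add_win A n"] E' n by (auto simp: ahead_by_two_def add_win_commute)
  qed
  moreover have "v (add_win B n) = r (Suc ?i) * v (add_win A (add_win B n))
      + (1 - r (Suc ?i)) * v (add_win B (add_win B n))"
  proof (cases "ahead_by_two k (add_win B n) B")
    case True
    then have "ahead_by_two k (add_win A (add_win B n)) B" "ahead_by_two k (add_win B (add_win B n)) B"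
      using n parity by (auto simp: ahead_by_two_def)
    then show ?thesis using True won by simp
  next
    case False
    then show ?thesis
      using step[of "add_win B n"] E' n by (auto simp: ahead_by_two_def add_win_commute)
  qed
  moreover have "(r ?i = a \<and> r (Suc ?i) = b) \<or> (r ?i = b \<and> r (Suc ?i) = a)"
    using r n(1) unfolding paired_def by blast
  ultimately show ?thesis
    by (elim disjE) (simp_all add: algebra_simps)
qed

text \<open>
  Backward induction on the total in steps of two, from an even total at which the values are known.
\<close>

lemma race_value_eq_from_level:
  assumes v: "race_value k E r v" "paired a b r" and v': "race_value k E r' v'" "paired a b r'"
    and E: "\<And>m. m \<in> E \<Longrightarrow> even (total m)" "\<And>m. m \<in> E \<Longrightarrow> v m = v' m"
    and level: "\<And>m. total m = N \<Longrightarrow> \<not> ahead_by_two k m A \<Longrightarrow> \<not> ahead_by_two k m B \<Longrightarrow> v m = v' m"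
    and N: "even N"
    and n: "even (total n)" "total n \<le> N"
  shows "v n = v' n"
  using n
proof (induction "N - total n" arbitrary: n rule: less_induct)
  case less
  consider "n \<in> E" | "ahead_by_two k n A" | "ahead_by_two k n B"
    | "total n = N" "\<not> ahead_by_two k n A" "\<not> ahead_by_two k n B"
    | "n \<notin> E" "total n < N" "\<not> ahead_by_two k n A" "\<not> ahead_by_two k n B"
    using less.prems by linarith
  then show ?case
  proof cases
    case 5
    have "Suc (Suc (total n)) \<le> N"
      using 5(2) less.prems(1) N by presburger
    then have IH: "v (add_win w (add_win z n)) = v' (add_win w (add_win z n))" for w z
      using less.hyps[of "add_win w (add_win z n)"] less.prems by (cases w; cases z) auto
    show ?thesis
      using race_value_two_steps[OF v E(1), of n] race_value_two_steps[OF v' E(1), of n] 5 less.prems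
      by (simp add: IH)
  qed (use v v' E level in \<open>auto simp: race_value_def\<close>)
qed

text \<open>
  A pair of rounds with success probabilities \<open>a\<close> and \<open>b\<close> has positive probability of being won
  twice by the same player.
\<close>

definition decisive :: "real \<Rightarrow> real \<Rightarrow> bool" where
  "decisive a b \<longleftrightarrow> 0 \<le> a \<and> a \<le> 1 \<and> 0 \<le> b \<and> b \<le> 1 \<and> 0 < a * b + (1 - a) * (1 - b)"

lemma decisive_complement: "decisive (1 - a) (1 - b) \<longleftrightarrow> decisive a b"
  by (auto simp: decisive_def algebra_simps)

text \<open>
  A game is always decisive, because \<open>a\<^sup>2 + (1 - a)\<^sup>2\<close> is positive for every \<open>a\<close>.
\<close>

lemma decisive_same: "0 \<le> a \<Longrightarrow> a \<le> 1 \<Longrightarrow> decisive a a"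
  unfolding decisive_def using sum_power2_gt_zero_iff[of a "1 - a"]
  by (auto simp: power2_eq_square)

lemma zero_of_contraction:
  fixes d :: "nat \<Rightarrow> real"
  assumes "\<And>j. \<bar>d j\<bar> \<le> 1" and "\<And>j. d j = c * d (Suc j)" and "0 \<le> c" "c < 1"
  shows "d 0 = 0"
proof -
  have "d 0 = c ^ j * d j" for j
  proof (induction j)
    case (Suc j)
    have "d 0 = c ^ j * (c * d (Suc j))"
      unfolding assms(2)[of j, symmetric] by (rule Suc.IH)
    then show ?case by (simp only: power_Suc2 mult.assoc)
  qed simp
  then have "\<bar>d 0\<bar> = c ^ j * \<bar>d j\<bar>" for j
    using assms(3) by (metis abs_mult abs_of_nonneg zero_le_power)
  then have "\<bar>d 0\<bar> \<le> c ^ j" for j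
    using mult_left_le[OF assms(1)[of j], of "c ^ j"] assms(3) by simp
  moreover have "(\<lambda>j. c ^ j) \<longlonglongrightarrow> 0"
    using assms(3,4) by (intro LIMSEQ_power_zero) auto
  ultimately have "\<bar>d 0\<bar> \<le> 0"
    by (intro LIMSEQ_le_const[of _ 0 "\<bar>d 0\<bar>"]) auto
  then show ?thesis by simp
qed

text \<open>
  From a tied score with both players within one point of the target, a pair of rounds either decides
  the race or leads back to a tie.  The bounded difference of two values thus contracts along the ties
  and vanishes there.  An undecided score with a large even total is such a tie, so backward induction
  settles all other even scores.
\<close>

theorem race_value_unique:
  assumes v: "race_value k {} r v" "paired a b r" "\<And>n. 0 \<le> v n" "\<And>n. v n \<le> 1"
    and v': "race_value k {} r' v'" "paired a b r'" "\<And>n. 0 \<le> v' n" "\<And>n. v' n \<le> 1"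
    and ab: "decisive a b"
    and n: "even (total n)"
  shows "v n = v' n"
proof -
  \<comment> \<open>The probability that a pair of rounds is shared between the players.\<close>
  define c where "c = a * (1 - b) + (1 - a) * b"
  have "0 \<le> a * (1 - b)" "0 \<le> (1 - a) * b"
    using ab by (simp_all add: decisive_def)
  moreover have "a * b + (1 - a) * (1 - b) = 1 - c"
    by (simp add: c_def algebra_simps)
  ultimately have c: "0 \<le> c" "c < 1"
    using ab unfolding decisive_def c_def by linarith+
  have tied: "v n = v' n" if "n A = n B" "k \<le> Suc (n A)" for n
  proof -
    \<comment> \<open>The ties that follow \<open>n\<close>.\<close>
    define m where "m j = (\<lambda>z::player. n z + j)" for j
    define d where "d j = v (m j) - v' (m j)" for j
    have [simp]: "add_win A (add_win B (m j)) = m (Suc j)" for j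
    proof
      show "add_win A (add_win B (m j)) z = m (Suc j) z" for z by (cases z) (auto simp: m_def)
    qed
    have mA: "ahead_by_two k (add_win A (add_win A (m j))) A"
      and mB: "ahead_by_two k (add_win B (add_win B (m j))) B"
      and not: "\<not> ahead_by_two k (m j) A" "\<not> ahead_by_two k (m j) B" "even (total (m j))" for j
      using that by (auto simp: m_def ahead_by_two_def)
    have ends: "v (add_win A (add_win A (m j))) = 1" "v' (add_win A (add_win A (m j))) = 1"
        "v (add_win B (add_win B (m j))) = 0" "v' (add_win B (add_win B (m j))) = 0" for j
      using v(1) v'(1) mA[of j] mB[of j] unfolding race_value_def by blast+
    have steps: "v (m j) = a * b + c * v (m (Suc j))" "v' (m j) = a * b + c * v' (m (Suc j))" for j
      using race_value_two_steps[OF v(1,2) _ not(3)[of j] _ not(1,2)]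
            race_value_two_steps[OF v'(1,2) _ not(3)[of j] _ not(1,2)]
      by (simp_all add: ends c_def)
    have "d j = c * d (Suc j)" for j
      using steps[of j] unfolding d_def by (simp add: right_diff_distrib)
    moreover have "\<bar>d j\<bar> \<le> 1" for j
      using v(3,4)[of "m j"] v'(3,4)[of "m j"] unfolding d_def by linarith
    ultimately have "d 0 = 0"
      using c by (intro zero_of_contraction[of d c])
    then show ?thesis by (simp add: d_def m_def)
  qed
  show ?thesis
  \<comment> \<open>With this total an undecided score must be a tie close to the target.\<close>
  proof (rule race_value_eq_from_level[OF v(1,2) v'(1,2), where N = "total n + 2 * k"])
    fix m assume "total m = total n + 2 * k" "\<not> ahead_by_two k m A" "\<not> ahead_by_two k m B"
    moreover from this(1) have "even (total m)"
      using n by simp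
    then have "m A \<noteq> Suc (m B)" "m B \<noteq> Suc (m A)"
      by auto
    ultimately have "m A = m B \<and> k \<le> Suc (m A)"
      unfolding ahead_by_two_def by auto
    then show "v m = v' m" using tied by blast
  qed (use n in auto)
qed

section \<open>Races as programs\<close>

definition race ::
    "nat \<Rightarrow> score set \<Rightarrow> (nat \<Rightarrow> player spmf) \<Rightarrow> (score \<Rightarrow> player spmf) \<Rightarrow> bool" where
  "race k E D R \<longleftrightarrow>
     (\<forall>n. ahead_by_two k n A \<longrightarrow> R n = return_spmf A) \<and>
     (\<forall>n. ahead_by_two k n B \<longrightarrow> R n = return_spmf B) \<and>
     (\<forall>n. n \<notin> E \<longrightarrow> \<not> ahead_by_two k n A \<longrightarrow> \<not> ahead_by_two k n B \<longrightarrow>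
        R n = bind_spmf (D (total n)) (\<lambda>w. R (add_win w n)))"

lemma not_both_ahead: "ahead_by_two k n A \<Longrightarrow> \<not> ahead_by_two k n B"
  by (auto simp: ahead_by_two_def)

definition sure :: "player spmf \<Rightarrow> bool" where
  "sure D \<longleftrightarrow> spmf D A + spmf D B = 1"

lemma spmf_B_of_sure: "sure D \<Longrightarrow> spmf D B = 1 - spmf D A"
  by (simp add: sure_def)

lemma race_value_win_A:
  assumes "race k E D R" "\<And>i. sure (D i)"
  shows "race_value k E (\<lambda>i. spmf (D i) A) (\<lambda>n. spmf (R n) A)"
  unfolding race_value_def
proof (intro conjI allI impI)
  fix n assume "n \<notin> E" "\<not> ahead_by_two k n A" "\<not> ahead_by_two k n B"
  then have "R n = bind_spmf (D (total n)) (\<lambda>w. R (add_win w n))"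
    using assms(1) unfolding race_def by blast
  from arg_cong[OF this, of "\<lambda>M. spmf M A"]
  show "spmf (R n) A = spmf (D (total n)) A * spmf (R (add_win A n)) A
      + (1 - spmf (D (total n)) A) * spmf (R (add_win B n)) A"
    by (simp only: spmf_bind_player spmf_B_of_sure[OF assms(2)])
qed (use assms(1) in \<open>auto simp: race_def\<close>)

text \<open>
  The probability that \<open>B\<close> does not win counts an endless race for \<open>A\<close>.  It solves the same recursion
  as the probability that \<open>A\<close> wins, so uniqueness of the value excludes endless races.
\<close>

lemma race_value_not_win_B:
  assumes "race k E D R" "\<And>i. sure (D i)"
  shows "race_value k E (\<lambda>i. spmf (D i) A) (\<lambda>n. 1 - spmf (R n) B)"
  unfolding race_value_def
proof (intro conjI allI impI)
  fix n assume "n \<notin> E" "\<not> ahead_by_two k n A" "\<not> ahead_by_two k n B"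
  then have "R n = bind_spmf (D (total n)) (\<lambda>w. R (add_win w n))"
    using assms(1) unfolding race_def by blast
  from arg_cong[OF this, of "\<lambda>M. spmf M B"]
  have "spmf (R n) B = spmf (D (total n)) A * spmf (R (add_win A n)) B
      + (1 - spmf (D (total n)) A) * spmf (R (add_win B n)) B"
    by (simp only: spmf_bind_player spmf_B_of_sure[OF assms(2)])
  then show "1 - spmf (R n) B = spmf (D (total n)) A * (1 - spmf (R (add_win A n)) B)
      + (1 - spmf (D (total n)) A) * (1 - spmf (R (add_win B n)) B)"
    by (simp add: algebra_simps)
qed (use assms(1) in \<open>auto simp: race_def\<close>)

text \<open>
  A pairing of rounds sees the rates of the two servers only as an unordered pair, so assignments of
  rates to servers that are related in this way give a race the same value.
\<close>

definition same_rates :: "(player \<Rightarrow> real) \<Rightarrow> (player \<Rightarrow> real) \<Rightarrow> bool" where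
  "same_rates f g \<longleftrightarrow> (f A = g A \<and> f B = g B) \<or> (f A = g B \<and> f B = g A)"

lemma same_rates_refl: "same_rates f f"
  by (simp add: same_rates_def)

lemma paired_same_rates: "same_rates f g \<Longrightarrow> paired (f A) (f B) r \<longleftrightarrow> paired (g A) (g B) r"
  unfolding same_rates_def using paired_commute by metis

lemma paired_alternating: "paired (f A) (f B) (\<lambda>i. f (if even i then s else opponent s))"
  by (cases s) (auto simp: paired_def)

text \<open>
  In the order \<open>XYYXXYYXX\<dots>\<close> the points \<open>2 * j\<close> and \<open>2 * j + 1\<close> are served by different players.
\<close>

lemma paired_tiebreak_server: "paired (f A) (f B) (\<lambda>i. f (tiebreak_server s i))"
proof -
  have "(f (tiebreak_server s i) = f A \<and> f (tiebreak_server s (Suc i)) = f B)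
      \<or> (f (tiebreak_server s i) = f B \<and> f (tiebreak_server s (Suc i)) = f A)" if "even i" for i
  proof -
    obtain j where "i = 2 * j" using \<open>even i\<close> by (elim evenE)
    then have "(i + 1) div 2 = j" "(Suc i + 1) div 2 = Suc j" by simp_all
    then show ?thesis by (cases s) (simp_all add: tiebreak_server_def)
  qed
  then show ?thesis by (simp add: paired_def)
qed

section \<open>Points\<close>

definition valid_probs :: "serve_probs \<Rightarrow> bool" where
  "valid_probs p \<longleftrightarrow> (\<forall>s. 0 \<le> p s \<and> p s \<le> 1)"

text \<open>
  Always the winning probability of \<open>A\<close>, whoever serves: only then do the rates of both servers enter
  one recursion.
\<close>

definition rate :: "serve_probs \<Rightarrow> player \<Rightarrow> real" where
  "rate p s = spmf (play_point p s) A"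

lemma spmf_play_point:
  assumes "valid_probs p"
  shows "spmf (play_point p s) s = p s" "spmf (play_point p s) (opponent s) = 1 - p s"
proof -
  have p: "0 \<le> p s" "p s \<le> 1" using assms by (auto simp: valid_probs_def)
  have "s \<noteq> opponent s" by (cases s) simp_all
  then have "(\<lambda>b. if b then s else opponent s) -` {s} = {True}"
    "(\<lambda>b. if b then s else opponent s) -` {opponent s} = {False}"
    by (auto split: if_splits)
  then show "spmf (play_point p s) s = p s" "spmf (play_point p s) (opponent s) = 1 - p s"
    unfolding play_point_def spmf_map using p
    by (simp_all only: spmf_conv_measure_spmf[symmetric] spmf_spmf_of_pmf pmf_bernoulli_True pmf_bernoulli_False)
qed

lemma sure_play_point: "valid_probs p \<Longrightarrow> sure (play_point p s)"
  using spmf_play_point[of p s] by (cases s) (auto simp: sure_def)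

lemma rate_simps:
  assumes "valid_probs p"
  shows "rate p A = p A" "rate p B = 1 - p B"
  using spmf_play_point[OF assms, of A] spmf_play_point[OF assms, of B] by (simp_all add: rate_def)

lemma rate_bounds: "0 \<le> rate p s" "rate p s \<le> 1"
  by (simp_all add: rate_def pmf_le_1)

section \<open>Games\<close>

lemma race_game: "race 4 {} (\<lambda>_. play_point p s) (game_from p s)"
  unfolding race_def
  by (intro conjI allI impI; subst game_from.simps) (auto dest: not_both_ahead)

lemma
  assumes "valid_probs p"
  shows game_value_win_A: "race_value 4 {} (\<lambda>_. rate p s) (\<lambda>n. spmf (game_from p s n) A)"
    and game_value_not_win_B: "race_value 4 {} (\<lambda>_. rate p s) (\<lambda>n. 1 - spmf (game_from p s n) B)"
  using race_value_win_A[OF race_game sure_play_point[OF assms]]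
    race_value_not_win_B[OF race_game sure_play_point[OF assms]]
  by (simp_all add: rate_def)

lemma game_value_unique:
  assumes "race_value 4 {} (\<lambda>_. a) v" "race_value 4 {} (\<lambda>_. a) v'" "0 \<le> a" "a \<le> 1"
    and "\<And>n. 0 \<le> v n" "\<And>n. v n \<le> 1" "\<And>n. 0 \<le> v' n" "\<And>n. v' n \<le> 1"
  shows "v zero_score = v' zero_score"
  using assms
  by (intro race_value_unique[where a = a and b = a and r = "\<lambda>_. a" and r' = "\<lambda>_. a"])
    (auto simp: paired_def decisive_same zero_score_def)

lemma zero_score_opponent: "zero_score \<circ> opponent = zero_score"
  by (auto simp: zero_score_def)

text \<open>
  Both \<open>spmf (game_from p s n) A\<close> and \<open>1 - spmf (game_from p s n) B\<close> are values of the same race.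
\<close>

lemma sure_play_game:
  assumes "valid_probs p"
  shows "sure (play_game p s)"
  using game_value_unique[OF game_value_win_A[OF assms] game_value_not_win_B[OF assms] rate_bounds]
  by (simp add: sure_def play_game_def pmf_le_1)

lemma play_game_cong:
  assumes "valid_probs p" "valid_probs p'" "rate p' s' = rate p s"
  shows "spmf (play_game p' s') A = spmf (play_game p s) A"
  using game_value_unique[OF game_value_win_A[OF assms(2)] game_value_win_A[OF assms(1), of s, folded assms(3)] rate_bounds]
  by (simp add: play_game_def pmf_le_1)

lemma play_game_mirror:
  assumes "valid_probs p" "valid_probs p'" "rate p' s' = 1 - rate p s"
  shows "spmf (play_game p' s') A = 1 - spmf (play_game p s) A"
proof -
  have "race_value 4 {} (\<lambda>_. rate p' s') (\<lambda>n. 1 - spmf (game_from p s (n \<circ> opponent)) A)"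
    using race_value_mirror[OF game_value_win_A[OF assms(1)], of "{}" s] assms(3) by simp
  from game_value_unique[OF game_value_win_A[OF assms(2)] this rate_bounds] show ?thesis
    by (simp add: play_game_def pmf_le_1 zero_score_opponent)
qed

section \<open>Tie-breakers\<close>

lemma race_tiebreak: "race K {} (\<lambda>i. play_point p (tiebreak_server s i)) (tiebreak_from p K s)"
  unfolding race_def
  by (intro conjI allI impI; subst tiebreak_from.simps) (auto dest: not_both_ahead)

lemma
  assumes "valid_probs p"
  shows tiebreak_value_win_A:
      "race_value K {} (\<lambda>i. rate p (tiebreak_server s i)) (\<lambda>n. spmf (tiebreak_from p K s n) A)"
    and tiebreak_value_not_win_B:
      "race_value K {} (\<lambda>i. rate p (tiebreak_server s i)) (\<lambda>n. 1 - spmf (tiebreak_from p K s n) B)"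
  using race_value_win_A[OF race_tiebreak sure_play_point[OF assms]]
    race_value_not_win_B[OF race_tiebreak sure_play_point[OF assms]]
  by (simp_all add: rate_def)

lemma sure_play_tiebreak:
  assumes "valid_probs p" "decisive (rate p A) (rate p B)"
  shows "sure (play_tiebreak p K s)"
  using race_value_unique[OF
      tiebreak_value_win_A[OF assms(1), of K s] paired_tiebreak_server _ _
      tiebreak_value_not_win_B[OF assms(1), of K s] paired_tiebreak_server _ _ assms(2),
      of zero_score]
  by (simp add: sure_def play_tiebreak_def pmf_le_1 zero_score_def)

lemma play_tiebreak_cong:
  assumes "valid_probs p" "valid_probs p'" "decisive (rate p A) (rate p B)"
    and "same_rates (rate p') (rate p)"
  shows "spmf (play_tiebreak p' K s') A = spmf (play_tiebreak p K s) A"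
  using race_value_unique[OF
      tiebreak_value_win_A[OF assms(2), of K s']
      paired_tiebreak_server[of "rate p'", unfolded paired_same_rates[OF assms(4)]] _ _
      tiebreak_value_win_A[OF assms(1), of K s] paired_tiebreak_server _ _ assms(3),
      of zero_score]
  by (simp add: play_tiebreak_def pmf_le_1 zero_score_def)

lemma play_tiebreak_mirror:
  assumes "valid_probs p" "valid_probs p'" "decisive (rate p A) (rate p B)"
    and "same_rates (rate p') (\<lambda>s. 1 - rate p s)"
  shows "spmf (play_tiebreak p' K s') A = 1 - spmf (play_tiebreak p K s) A"
proof -
  have 1: "race_value K {} (\<lambda>i. 1 - rate p (tiebreak_server s i))
      (\<lambda>n. 1 - spmf (tiebreak_from p K s (n \<circ> opponent)) A)"
    using race_value_mirror[OF tiebreak_value_win_A[OF assms(1)], of "{}" K s] by simp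
  have 2: "decisive (1 - rate p A) (1 - rate p B)"
    using assms(3) by (simp add: decisive_complement)
  show ?thesis
    using race_value_unique[OF
        tiebreak_value_win_A[OF assms(2), of K s']
        paired_tiebreak_server[of "rate p'", unfolded paired_same_rates[OF assms(4)]] _ _
        1 paired_tiebreak_server[of "\<lambda>s. 1 - rate p s"] _ _ 2, of zero_score]
    by (simp add: play_tiebreak_def pmf_le_1 zero_score_opponent) (simp add: zero_score_def)
qed

section \<open>Sets\<close>

abbreviation six_all :: "score set" where
  "six_all \<equiv> {g. g A = 6 \<and> g B = 6}"

text \<open>
  The parity of the number of games played determines the server, so a set is a race whose state is
  the score alone.  Here \<open>s\<close> is the player who started the set.
\<close>

definition set_winner_from :: "serve_probs \<Rightarrow> nat \<Rightarrow> player \<Rightarrow> score \<Rightarrow> player spmf" where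
  "set_winner_from p K s g =
     map_spmf fst (set_from p K (if even (total g) then s else opponent s) g)"

lemma race_set:
  "race 6 six_all (\<lambda>i. play_game p (if even i then s else opponent s)) (set_winner_from p K s)"
proof -
  have server: "(if even (total (add_win w g)) then s else opponent s)
      = opponent (if even (total g) then s else opponent s)" for w g
    by (cases w) auto
  show ?thesis
    unfolding race_def
  proof (intro conjI allI impI)
    \<comment> \<open>The tie-breaker test comes first in \<open>set_from\<close>, but a score of 6-6 has no lead.\<close>
    fix g assume "ahead_by_two 6 g A"
    then show "set_winner_from p K s g = return_spmf A"
      unfolding set_winner_from_def by (subst set_from.simps) (auto simp: ahead_by_two_def)
  next
    fix g assume "ahead_by_two 6 g B"
    then show "set_winner_from p K s g = return_spmf B"
      unfolding set_winner_from_def by (subst set_from.simps) (auto simp: ahead_by_two_def)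
  next
    fix g assume g: "g \<notin> six_all" "\<not> ahead_by_two 6 g A" "\<not> ahead_by_two 6 g B"
    let ?t = "if even (total g) then s else opponent s"
    have "set_winner_from p K s g
        = bind_spmf (play_game p ?t) (\<lambda>w. map_spmf fst (set_from p K (opponent ?t) (add_win w g)))"
      unfolding set_winner_from_def using g by (subst set_from.simps) (auto simp: map_spmf_bind_spmf o_def)
    then show "set_winner_from p K s g = bind_spmf (play_game p ?t) (\<lambda>w. set_winner_from p K s (add_win w g))"
      unfolding set_winner_from_def server .
  qed
qed

lemma set_winner_six_all: "g \<in> six_all \<Longrightarrow> set_winner_from p K s g = play_tiebreak p K s"
  unfolding set_winner_from_def by (subst set_from.simps) (simp add: map_spmf_conv_bind_spmf)

abbreviation set_winner :: "serve_probs \<Rightarrow> nat \<Rightarrow> player \<Rightarrow> player spmf" where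
  "set_winner p K s \<equiv> map_spmf fst (play_set p K s)"

lemma set_winner_eq: "set_winner p K s = set_winner_from p K s zero_score"
  by (simp add: set_winner_from_def play_set_def zero_score_def)

text \<open>
  After 12 games a set is either decided or at 6-6, where the tie-breaker fixes the value.  The
  rest is backward induction.
\<close>

lemma set_value_unique:
  assumes "race_value 6 six_all r v" "paired a b r" "race_value 6 six_all r' v'" "paired a b r'"
    and "\<And>g. g \<in> six_all \<Longrightarrow> v g = v' g"
  shows "v zero_score = v' zero_score"
proof (rule race_value_eq_from_level[OF assms(1-4), where N = 12])
  fix g assume g: "total g = 12" "\<not> ahead_by_two 6 g A" "\<not> ahead_by_two 6 g B"
  then have "g \<in> six_all"
    by (auto simp: ahead_by_two_def)
  then show "v g = v' g" by (rule assms(5))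
qed (use assms(5) in \<open>auto simp: zero_score_def\<close>)

lemma
  assumes "valid_probs p"
  shows set_value_win_A:
      "race_value 6 six_all (\<lambda>i. spmf (play_game p (if even i then s else opponent s)) A)
         (\<lambda>g. spmf (set_winner_from p K s g) A)"
    and set_value_not_win_B:
      "race_value 6 six_all (\<lambda>i. spmf (play_game p (if even i then s else opponent s)) A)
         (\<lambda>g. 1 - spmf (set_winner_from p K s g) B)"
  using race_value_win_A[OF race_set sure_play_game[OF assms]]
    race_value_not_win_B[OF race_set sure_play_game[OF assms]] by blast+

lemma sure_set_winner:
  assumes "valid_probs p" "decisive (rate p A) (rate p B)"
  shows "sure (set_winner p K s)"
  using set_value_unique[OF
      set_value_win_A[OF assms(1), of s K] paired_alternating[of "\<lambda>s. spmf (play_game p s) A"]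
      set_value_not_win_B[OF assms(1), of s K] paired_alternating[of "\<lambda>s. spmf (play_game p s) A"]]
    sure_play_tiebreak[OF assms, of K s]
  unfolding set_winner_eq sure_def by (simp add: set_winner_six_all)

text \<open>
  With \<open>p' = p\<close> this is the independence of the set winner from the first server; with the rates of
  the two servers exchanged it is the duality behind the last claim of the theorem.
\<close>

lemma set_winner_cong:
  assumes "valid_probs p" "valid_probs p'" "decisive (rate p A) (rate p B)"
    and "same_rates (rate p') (rate p)"
  shows "spmf (set_winner p' K s') A = spmf (set_winner p K s) A"
proof -
  have "same_rates (\<lambda>s. spmf (play_game p' s) A) (\<lambda>s. spmf (play_game p s) A)"
    using assms(4) play_game_cong[OF assms(1,2)] unfolding same_rates_def by metis
  note pairs = paired_alternating[of "\<lambda>s. spmf (play_game p' s) A", unfolded paired_same_rates[OF this]]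
  show ?thesis
    using set_value_unique[OF
        set_value_win_A[OF assms(2), of s' K] pairs
        set_value_win_A[OF assms(1), of s K] paired_alternating[of "\<lambda>s. spmf (play_game p s) A"]]
      play_tiebreak_cong[OF assms, of K s' s]
    unfolding set_winner_eq by (simp add: set_winner_six_all)
qed

lemma set_winner_mirror:
  assumes "valid_probs p" "valid_probs p'" "decisive (rate p A) (rate p B)"
    and "same_rates (rate p') (\<lambda>s. 1 - rate p s)"
  shows "spmf (set_winner p' K s') A = 1 - spmf (set_winner p K s) A"
proof -
  have "same_rates (\<lambda>s. spmf (play_game p' s) A) (\<lambda>s. 1 - spmf (play_game p s) A)"
    using assms(4) play_game_mirror[OF assms(1,2)] unfolding same_rates_def by metis
  note pairs = paired_alternating[of "\<lambda>s. spmf (play_game p' s) A", unfolded paired_same_rates[OF this]]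
  have "race_value 6 six_all (\<lambda>i. 1 - spmf (play_game p (if even i then s else opponent s)) A)
      (\<lambda>g. 1 - spmf (set_winner_from p K s (g \<circ> opponent)) A)"
    by (rule race_value_mirror[OF set_value_win_A[OF assms(1)]]) auto
  from set_value_unique[OF set_value_win_A[OF assms(2), of s' K] pairs
        this paired_alternating[of "\<lambda>s. 1 - spmf (play_game p s) A"]]
    play_tiebreak_mirror[OF assms, of K s' s]
  show ?thesis
    unfolding set_winner_eq by (simp add: set_winner_six_all zero_score_opponent)
qed

section \<open>Matches\<close>

abbreviation spmf_prob :: "'a spmf \<Rightarrow> 'a set \<Rightarrow> real" where
  "spmf_prob M X \<equiv> measure (measure_spmf M) X"

lemma spmf_prob_bind: "spmf_prob (bind_spmf M f) X = (\<integral>x. spmf_prob (f x) X \<partial>measure_spmf M)"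
proof -
  have "spmf_prob N X = spmf (map_spmf (\<lambda>x. x \<in> X) N) True" for N :: "'a spmf"
  proof -
    have "(\<lambda>x. x \<in> X) -` {True} = X" by auto
    then show ?thesis by (simp only: spmf_map)
  qed
  then show ?thesis
    by (simp add: map_spmf_bind_spmf spmf_bind o_def)
qed

definition set_win_prob :: "serve_probs \<Rightarrow> nat \<Rightarrow> real" where
  "set_win_prob p K = spmf (set_winner p K A) A"

lemma set_win_prob_bounds: "0 \<le> set_win_prob p K" "set_win_prob p K \<le> 1"
  by (simp_all add: set_win_prob_def pmf_le_1)

text \<open>
  The next server \<open>t\<close> and the winner \<open>w\<close> of a set are dependent in general, but if the continuation
  has the same probability for every \<open>t\<close>, the set acts as a single coin flip.
\<close>

lemma spmf_prob_play_set_bind: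
  assumes p: "valid_probs p" "decisive (rate p A) (rate p B)"
    and g: "\<And>w t. spmf_prob (f w t) X = g w"
  shows "spmf_prob (bind_spmf (play_set p K s) (\<lambda>(w, t). f w t)) X
    = set_win_prob p K * g A + (1 - set_win_prob p K) * g B"
proof -
  have "spmf_prob (bind_spmf (play_set p K s) (\<lambda>(w, t). f w t)) X
      = (\<integral>x. g (fst x) \<partial>measure_spmf (play_set p K s))"
    by (simp add: spmf_prob_bind case_prod_unfold g)
  also have "\<dots> = (\<integral>w. g w \<partial>measure_spmf (set_winner p K s))"
    by (subst measure_map_spmf_conv_distr) (simp add: integral_distr)
  also have "\<dots> = spmf (set_winner p K s) A * g A + (1 - spmf (set_winner p K s) A) * g B"
    using spmf_B_of_sure[OF sure_set_winner[OF p, of K s]] by (simp only: integral_spmf_player)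
  also have "spmf (set_winner p K s) A = set_win_prob p K"
    unfolding set_win_prob_def by (rule set_winner_cong[OF p(1,1,2) same_rates_refl])
  finally show ?thesis .
qed

lemma spmf_prob_match_step:
  assumes "valid_probs p" "decisive (rate p A) (rate p B)" "m A \<noteq> Q + 1" "m B \<noteq> Q + 1"
    and "\<And>w t. spmf_prob (match_from p K0 K1 Q t (add_win w m)) X = g w"
    and "r = set_win_prob p (if total m = 2 * Q then K1 else K0)"
  shows "spmf_prob (match_from p K0 K1 Q s m) X = r * g A + (1 - r) * g B"
  using spmf_prob_play_set_bind[OF assms(1,2), where f = "\<lambda>w t. match_from p K0 K1 Q t (add_win w m)"
      and X = X and g = g, OF assms(5), of "if total m = 2 * Q then K1 else K0" s] assms(3,4,6)
  by (subst match_from.simps) simp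

lemma spmf_prob_match_end:
  assumes "m A = Q + 1 \<or> m B = Q + 1"
  shows "spmf_prob (match_from p K0 K1 Q s m) X = indicator X m"
  using assms by (subst match_from.simps) (simp add: measure_spmf_return_spmf measure_return)

lemma match_score_bounds:
  assumes "m' \<in> set_spmf (match_from p K0 K1 Q s m)"
    and "m A \<le> Q + 1" "m B \<le> Q + 1" "total m \<le> 2 * Q + 1"
  shows "m B \<le> m' B \<and> total m' \<le> 2 * Q + 1"
  using assms
proof (induction "2 * Q + 1 - total m" arbitrary: s m rule: less_induct)
  case less
  show ?case
  proof (cases "m A = Q + 1 \<or> m B = Q + 1")
    case True
    then have "match_from p K0 K1 Q s m = return_spmf m"
      by (subst match_from.simps) simp
    then show ?thesis using less.prems by simp
  next
    case False
    then have "m' \<in> set_spmf (bind_spmf (play_set p (if total m = 2 * Q then K1 else K0) s)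
        (\<lambda>(w, t). match_from p K0 K1 Q t (add_win w m)))"
      using less.prems(1) by (subst (asm) match_from.simps) (simp del: set_bind_spmf)
    then obtain w t where wt: "m' \<in> set_spmf (match_from p K0 K1 Q t (add_win w m))"
      by (auto simp: set_bind_spmf bind_UNION)
    have "add_win w m B \<le> m' B \<and> total m' \<le> 2 * Q + 1"
      by (rule less.hyps[OF _ wt]) (use False less.prems in \<open>cases w; auto\<close>)+
    then show ?thesis by (cases w) auto
  qed
qed

lemma match_score_prob_0:
  assumes "h < m B" "m A \<le> Q + 1" "m B \<le> Q + 1" "total m \<le> 2 * Q + 1"
  shows "spmf_prob (match_from p K0 K1 Q s m) {m. m A = Q + 1 \<and> m B = h} = 0"
  using match_score_bounds[OF _ assms(2-4)] assms(1)
  by (subst measure_spmf_zero_iff) fastforce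

text \<open>
  For the final score \<open>(Q + 1, h)\<close>, \<open>A\<close> still has to win \<open>a + 1\<close> sets and \<open>B\<close> has to win \<open>b\<close>.  \<open>A\<close> wins the
  last set, and the other \<open>a + b\<close> sets may be won in any order; the last set can use \<open>K1\<close> only when
  \<open>h = Q\<close>.  The claim holds for every server \<open>s\<close>, which makes the induction go through.
\<close>

lemma match_score_prob:
  assumes p: "valid_probs p" "decisive (rate p A) (rate p B)" and "h \<le> Q"
    and "m A + a = Q" "m B + b = h"
  shows "spmf_prob (match_from p K0 K1 Q s m) {m. m A = Q + 1 \<and> m B = h}
    = real (a + b choose b) * set_win_prob p K0 ^ a * (1 - set_win_prob p K0) ^ b
      * set_win_prob p (if h = Q then K1 else K0)"
  using assms(4,5)
proof (induction "a + b" arbitrary: a b m s rule: less_induct)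
  case less
  let ?X = "{m. m A = Q + 1 \<and> m B = h}"
  let ?r = "set_win_prob p K0" and ?t = "set_win_prob p (if h = Q then K1 else K0)"
  \<comment> \<open>\<open>gA\<close> and \<open>gB\<close> are the probabilities after the next set is won by \<open>A\<close> and by \<open>B\<close>.\<close>
  define F where "F a b = real (a + b choose b) * ?r ^ a * (1 - ?r) ^ b * ?t" for a b
  define gA where "gA = (if a = 0 then (if b = 0 then 1 else 0) else F (a - 1) b)"
  define gB where "gB = (if b = 0 then 0 else F a (b - 1))"
  have A: "spmf_prob (match_from p K0 K1 Q t (add_win A m)) ?X = gA" for t
  proof (cases "a = 0")
    case True
    then show ?thesis
      using less.prems by (subst spmf_prob_match_end) (auto simp: gA_def indicator_def)
  next
    case False
    then show ?thesis
      using less.prems by (subst less.hyps[where a = "a - 1" and b = b]) (auto simp: gA_def F_def)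
  qed
  have B: "spmf_prob (match_from p K0 K1 Q t (add_win B m)) ?X = gB" for t
  proof (cases "b = 0")
    case True
    then show ?thesis
      using less.prems \<open>h \<le> Q\<close> by (subst match_score_prob_0) (auto simp: gB_def)
  next
    case False
    then show ?thesis
      using less.prems by (subst less.hyps[where a = a and b = "b - 1"]) (auto simp: gB_def F_def)
  qed
  let ?q = "set_win_prob p (if total m = 2 * Q then K1 else K0)"
  have "spmf_prob (match_from p K0 K1 Q s m) ?X = ?q * gA + (1 - ?q) * gB"
  proof -
    have ongoing: "m A \<noteq> Q + 1" "m B \<noteq> Q + 1"
      using less.prems \<open>h \<le> Q\<close> by auto
    have step: "spmf_prob (match_from p K0 K1 Q t (add_win w m)) ?X = (case w of A \<Rightarrow> gA | B \<Rightarrow> gB)" for w t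
      using A B by (cases w) simp_all
    show ?thesis
      using spmf_prob_match_step[OF p ongoing step refl, of s] by (simp only: player.case)
  qed
  also have "\<dots> = F a b"
  proof (cases "a = 0 \<and> b = 0")
    case True
    then have "total m = 2 * Q \<longleftrightarrow> h = Q"
      using less.prems by auto
    then show ?thesis using True by (simp add: gA_def gB_def F_def)
  next
    case False
    then have "total m \<noteq> 2 * Q"
      using less.prems \<open>h \<le> Q\<close> by auto
    then have "?q = ?r" by simp
    then show ?thesis
      using False by (cases a; cases b) (simp_all add: gA_def gB_def F_def algebra_simps)
  qed
  finally show ?case by (simp add: F_def)
qed

lemma match_win_prob_sum:
  "spmf_prob (play_match p K0 K1 Q s) {m. m A = Q + 1}
    = (\<Sum>h\<le>Q. spmf_prob (play_match p K0 K1 Q s) {m. m A = Q + 1 \<and> m B = h})"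
proof -
  let ?M = "play_match p K0 K1 Q s"
  have "spmf_prob ?M {m. m A = Q + 1} = spmf_prob ?M (\<Union>h\<le>Q. {m. m A = Q + 1 \<and> m B = h})"
  proof (rule measure_spmf.finite_measure_eq_AE)
    \<comment> \<open>At most \<open>2 * Q + 1\<close> sets are played, so \<open>A\<close> winning \<open>Q + 1\<close> leaves at most \<open>Q\<close> for \<open>B\<close>.\<close>
    have "m B \<le> Q" if "m \<in> set_spmf ?M" "m A = Q + 1" for m
      using match_score_bounds[of m p K0 K1 Q s zero_score] that
      by (simp add: play_match_def zero_score_def)
    then show "AE m in measure_spmf ?M.
        m \<in> {m. m A = Q + 1} \<longleftrightarrow> m \<in> (\<Union>h\<le>Q. {m. m A = Q + 1 \<and> m B = h})"
      by (auto simp: AE_measure_spmf_iff)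
  qed auto
  also have "\<dots> = (\<Sum>h\<le>Q. spmf_prob ?M {m. m A = Q + 1 \<and> m B = h})"
    by (rule measure_spmf.finite_measure_finite_Union) (auto simp: disjoint_family_on_def)
  finally show ?thesis .
qed

section \<open>Binomial distributions\<close>

lemma pmf_prob_bind:
  "measure_pmf.prob (bind_pmf M f) X = measure_pmf.expectation M (\<lambda>x. measure_pmf.prob (f x) X)"
proof -
  have "measure_pmf.prob N X = pmf (map_pmf (\<lambda>x. x \<in> X) N) True" for N
  proof -
    have "(\<lambda>x. x \<in> X) -` {True} = X" by auto
    then show ?thesis by (simp only: pmf_map)
  qed
  then show ?thesis
    by (simp add: map_bind_pmf pmf_bind)
qed

lemma binomial_pmf_prob_Suc:
  assumes "r \<in> {0..1}"
  shows "measure_pmf.prob (binomial_pmf (Suc n) r) {Suc k..}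
    = r * measure_pmf.prob (binomial_pmf n r) {k..} + (1 - r) * measure_pmf.prob (binomial_pmf n r) {Suc k..}"
proof -
  have 1: "Suc -` {Suc k..} = {k..}" by auto
  have "binomial_pmf (Suc n) r
      = bind_pmf (bernoulli_pmf r) (\<lambda>b. map_pmf (if b then Suc else id) (binomial_pmf n r))"
    unfolding binomial_pmf_Suc[OF assms] map_pmf_def
    by (intro bind_pmf_cong refl) (auto simp: id_def)
  then have "measure_pmf.prob (binomial_pmf (Suc n) r) {Suc k..}
      = (\<integral>b. measure_pmf.prob (map_pmf (if b then Suc else id) (binomial_pmf n r)) {Suc k..} \<partial>bernoulli_pmf r)"
    by (simp only: pmf_prob_bind)
  also have "\<dots> = r * measure_pmf.prob (map_pmf Suc (binomial_pmf n r)) {Suc k..}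
      + (1 - r) * measure_pmf.prob (map_pmf id (binomial_pmf n r)) {Suc k..}"
    using assms by (subst integral_bernoulli_pmf) auto
  finally show ?thesis
    by (simp add: 1 id_def)
qed

lemma binomial_pmf_add:
  assumes "r \<in> {0..1}"
  shows "map_pmf (\<lambda>(u, v). u + v) (pair_pmf (binomial_pmf m r) (binomial_pmf n r)) = binomial_pmf (m + n) r"
proof (induction m)
  case 0
  then show ?case
    using assms by (simp add: binomial_pmf_0 pair_return_pmf1 pmf.map_comp o_def)
next
  case (Suc m)
  have "map_pmf (\<lambda>(u, v). u + v) (pair_pmf (binomial_pmf (Suc m) r) (binomial_pmf n r))
      = bind_pmf (bernoulli_pmf r) (\<lambda>b. map_pmf (\<lambda>k. (if b then 1 else 0) + k)
          (map_pmf (\<lambda>(u, v). u + v) (pair_pmf (binomial_pmf m r) (binomial_pmf n r))))"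
    by (simp add: binomial_pmf_Suc[OF assms] pair_pmf_def map_pmf_def bind_assoc_pmf bind_return_pmf add.assoc)
  also have "\<dots> = binomial_pmf (Suc m + n) r"
    unfolding Suc.IH unfolding add_Suc binomial_pmf_Suc[OF assms] map_pmf_def ..
  finally show ?case .
qed

text \<open>
  Playing on to the full number of sets does not change the winner of the match: of the remaining
  \<open>a + b - 1\<close> sets, either \<open>A\<close> wins at least \<open>a\<close> or \<open>B\<close> wins at least \<open>b\<close>, and not both.
\<close>

lemma match_win_prob_binomial:
  assumes p: "valid_probs p" "decisive (rate p A) (rate p B)"
    and "m A + a = Q + 1" "m B + b = Q + 1" "0 < a + b"
  shows "spmf_prob (match_from p K K Q s m) {m. m A = Q + 1}
    = measure_pmf.prob (binomial_pmf (a + b - 1) (set_win_prob p K)) {a..}"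
  using assms(3-5)
proof (induction "a + b" arbitrary: a b m s rule: less_induct)
  case less
  let ?X = "{m. m A = Q + 1}" and ?r = "set_win_prob p K"
  have r: "?r \<in> {0..1}" by (simp add: set_win_prob_bounds)
  show ?case
  proof (cases "a = 0 \<or> b = 0")
    case True
    then have over: "spmf_prob (match_from p K K Q s m) ?X = (if a = 0 then 1 else 0)"
      using less.prems by (subst spmf_prob_match_end) auto
    show ?thesis
    proof (cases "a = 0")
      case True
      then show ?thesis using over by simp
    next
      case False
      have "set_pmf (binomial_pmf (a + b - 1) ?r) \<subseteq> {..a + b - 1}"
        using set_pmf_binomial_eq[of ?r] r by auto
      then have "measure_pmf.prob (binomial_pmf (a + b - 1) ?r) {a..} = 0"
        using False True by (subst measure_pmf_zero_iff) auto
      then show ?thesis using False over by simp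
    qed
  next
    case False
    then obtain a' b' where ab: "a = Suc a'" "b = Suc b'"
      by (metis not0_implies_Suc)
    have "spmf_prob (match_from p K K Q s m) ?X
        = ?r * measure_pmf.prob (binomial_pmf (a' + b') ?r) {a'..}
          + (1 - ?r) * measure_pmf.prob (binomial_pmf (a' + b') ?r) {Suc a'..}"
    proof -
      let ?g = "case_player (measure_pmf.prob (binomial_pmf (a' + b') ?r) {a'..})
          (measure_pmf.prob (binomial_pmf (a' + b') ?r) {Suc a'..})"
      have ongoing: "m A \<noteq> Q + 1" "m B \<noteq> Q + 1"
        using less.prems ab by auto
      have step: "spmf_prob (match_from p K K Q t (add_win w m)) ?X = ?g w" for w t
        using less.hyps[of a' b "add_win A m" t] less.hyps[of a b' "add_win B m" t] less.prems ab
        by (cases w) simp_all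
      show ?thesis
        using spmf_prob_match_step[OF p ongoing step refl, of s] by simp
    qed
    then show ?thesis
      by (simp add: ab binomial_pmf_prob_Suc[OF r])
  qed
qed

section \<open>The probabilities of the theorem\<close>

text \<open>
  Vandermonde's identity, weighted by the powers that occur when the \<open>k\<close> successes among \<open>m + n\<close>
  trials are split according to which group they fall in.
\<close>

lemma vandermonde_weighted:
  fixes r q :: real
  shows "(\<Sum>j=0..k. real (m choose j) * real (n choose (k - j)) * r ^ j * q ^ (m - j) * r ^ (k - j) * q ^ (n - (k - j)))
    = real ((m + n) choose k) * r ^ k * q ^ (m + n - k)"
proof -
  have summand: "real (m choose j) * real (n choose (k - j)) * r ^ j * q ^ (m - j) * r ^ (k - j) * q ^ (n - (k - j))
      = real ((m choose j) * (n choose (k - j))) * (r ^ k * q ^ (m + n - k))" if "j \<le> k" for j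
  proof (cases "j \<le> m \<and> k - j \<le> n")
    case True
    then have "m - j + (n - (k - j)) = m + n - k" using that by auto
    then have "q ^ (m + n - k) = q ^ (m - j) * q ^ (n - (k - j))"
      by (metis power_add)
    moreover have "r ^ k = r ^ j * r ^ (k - j)"
      using that by (metis le_add_diff_inverse power_add)
    ultimately show ?thesis by (simp only: of_nat_mult mult_ac)
  next
    \<comment> \<open>A truncated exponent occurs only next to a vanishing binomial coefficient.\<close>
    case False
    then show ?thesis by (auto simp: binomial_eq_0)
  qed
  have "(\<Sum>j=0..k. real (m choose j) * real (n choose (k - j)) * r ^ j * q ^ (m - j) * r ^ (k - j) * q ^ (n - (k - j)))
      = (\<Sum>j=0..k. real ((m choose j) * (n choose (k - j))) * (r ^ k * q ^ (m + n - k)))"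
    by (intro sum.cong refl summand) simp
  also have "\<dots> = real (\<Sum>j\<le>k. (m choose j) * (n choose (k - j))) * (r ^ k * q ^ (m + n - k))"
    by (simp only: atLeast0AtMost sum_distrib_right of_nat_sum)
  finally show ?thesis by (simp only: vandermonde mult.assoc)
qed

definition playable :: "real \<Rightarrow> real \<Rightarrow> bool" where
  "playable x y \<longleftrightarrow> 0 \<le> x \<and> x \<le> 1 \<and> 0 \<le> y \<and> y \<le> 1 \<and>
     \<not> (x = 0 \<and> y = 0) \<and> \<not> (x = 1 \<and> y = 1)"

lemma valid_serve_probs_of:
  assumes "playable x y"
  shows "valid_probs (serve_probs_of x y)"
  using assms by (auto simp: valid_probs_def serve_probs_of_def playable_def split: player.split)

lemma rate_serve_probs_of:
  assumes "playable x y"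
  shows "rate (serve_probs_of x y) A = x" "rate (serve_probs_of x y) B = 1 - y"
  using rate_simps[OF valid_serve_probs_of[OF assms]] by (simp_all add: serve_probs_of_def)

text \<open>
  With \<open>a = x\<close> and \<open>b = 1 - y\<close>, both \<open>a * b\<close> and \<open>(1 - a) * (1 - b)\<close> vanish only at \<open>x = y = 0\<close> and
  \<open>x = y = 1\<close>.
\<close>

lemma decisive_serve_probs_of:
  assumes "playable x y"
  shows "decisive (rate (serve_probs_of x y) A) (rate (serve_probs_of x y) B)"
proof -
  have xy: "0 \<le> x" "x \<le> 1" "0 \<le> y" "y \<le> 1" "\<not> (x = 0 \<and> y = 0)" "\<not> (x = 1 \<and> y = 1)"
    using assms by (auto simp: playable_def)
  then have nonneg: "0 \<le> x * (1 - y)" "0 \<le> (1 - x) * y" by simp_all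
  have "x * (1 - y) \<noteq> 0 \<or> (1 - x) * y \<noteq> 0"
    using xy by auto
  then have "0 < x * (1 - y) + (1 - x) * y"
    using nonneg by linarith
  then show ?thesis
    using xy unfolding rate_serve_probs_of[OF assms] by (simp add: decisive_def)
qed

lemma theta_S_eq: "theta_S x y K = set_win_prob (serve_probs_of x y) K"
proof -
  have "fst -` {A} = {r :: player \<times> player. fst r = A}" by auto
  then show ?thesis by (simp add: theta_S_def set_win_prob_def spmf_map)
qed

text \<open>
  Exchanging \<open>x\<close> and \<open>y\<close> renames the players and at the same time changes the first server.  The
  renaming replaces the winning probability by its complement, and the change of server has no effect.
\<close>

lemma theta_S_swap:
  assumes "playable x y"
  shows "theta_S y x K = 1 - theta_S x y K"
proof -
  have yx: "playable y x" using assms by (auto simp: playable_def)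
  show ?thesis
    unfolding theta_S_eq set_win_prob_def
    by (rule set_winner_mirror[OF valid_serve_probs_of[OF assms] valid_serve_probs_of[OF yx]
          decisive_serve_probs_of[OF assms]])
      (simp add: same_rates_def rate_serve_probs_of assms yx)
qed

lemma playable_dual: "playable x y \<Longrightarrow> playable (1 - y) (1 - x)"
  by (auto simp: playable_def)

text \<open>
  \<open>A\<close> wins the points served by \<open>A\<close> with probability \<open>x\<close> and those served by \<open>B\<close> with probability
  \<open>1 - y\<close>.  Passing to \<open>(1 - y, 1 - x)\<close> exchanges these two rates.
\<close>

lemma theta_S_dual:
  assumes "playable x y"
  shows "theta_S (1 - y) (1 - x) K = theta_S x y K"
  unfolding theta_S_eq set_win_prob_def
  by (rule set_winner_cong[OF valid_serve_probs_of[OF assms]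
        valid_serve_probs_of[OF playable_dual[OF assms]] decisive_serve_probs_of[OF assms]])
    (simp add: same_rates_def rate_serve_probs_of assms playable_dual)

lemma theta_M_score_eq:
  assumes "playable x y" "h \<le> Q"
  shows "theta_M_score (Q + 1) h x y K0 K1 Q
    = real (Q + h choose h) * theta_S x y K0 ^ Q * (1 - theta_S x y K0) ^ h
      * theta_S x y (if h = Q then K1 else K0)"
  unfolding theta_M_score_def play_match_def theta_S_eq
  by (rule match_score_prob[OF valid_serve_probs_of[OF assms(1)] decisive_serve_probs_of[OF assms(1)] assms(2)])
    (simp_all add: zero_score_def)

lemma theta_M_eq_sum: "theta_M x y K0 K1 Q = (\<Sum>h\<le>Q. theta_M_score (Q + 1) h x y K0 K1 Q)"
  unfolding theta_M_def theta_M_score_def by (rule match_win_prob_sum)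

text \<open>
  Conditioning on the last of \<open>2 * Q + 1\<close> sets: \<open>A\<close> wins the match by winning at least \<open>Q + 1\<close> of the first
  \<open>2 * Q\<close> sets, or exactly \<open>Q\<close> of them and the last one.
\<close>

lemma theta_M_binomial:
  assumes "playable x y"
  shows "theta_M x y K K Q
    = measure_pmf.prob (indep_binomials Q (theta_S x y K) Q (theta_S x y K)) {(u, v). u + v \<ge> Q + 1}
      + measure_pmf.prob (indep_binomials Q (theta_S x y K) Q (theta_S x y K)) {(u, v). u + v = Q}
        * theta_S x y K"
proof -
  let ?r = "theta_S x y K"
  let ?b = "measure_pmf.prob (binomial_pmf (2 * Q) ?r)"
  let ?i = "measure_pmf.prob (indep_binomials Q ?r Q ?r)"
  have r: "?r \<in> {0..1}" by (simp add: theta_S_eq set_win_prob_bounds)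
  have sum: "?i {(u, v). u + v \<in> X} = ?b X" for X
  proof -
    have "(\<lambda>(u, v). u + v) -` X = {(u, v). u + v \<in> X}" by auto
    moreover have "?b X = measure_pmf.prob (map_pmf (\<lambda>(u, v). u + v) (indep_binomials Q ?r Q ?r)) X"
      by (simp only: indep_binomials_def binomial_pmf_add[OF r] mult_2)
    ultimately show ?thesis by simp
  qed
  have "theta_M x y K K Q = measure_pmf.prob (binomial_pmf (Suc (2 * Q)) ?r) {Suc Q..}"
    using match_win_prob_binomial[OF valid_serve_probs_of[OF assms] decisive_serve_probs_of[OF assms],
        of zero_score "Q + 1" Q "Q + 1" K A]
    by (simp add: theta_M_def play_match_def theta_S_eq zero_score_def mult_2)
  also have "\<dots> = ?r * ?b {Q..} + (1 - ?r) * ?b {Suc Q..}"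
    by (rule binomial_pmf_prob_Suc[OF r])
  also have "?b {Q..} = ?b {Q} + ?b {Suc Q..}"
  proof -
    have "?b ({Q} \<union> {Suc Q..}) = ?b {Q} + ?b {Suc Q..}"
      by (rule measure_pmf.finite_measure_Union) auto
    moreover have "{Q} \<union> {Suc Q..} = {Q..}" by auto
    ultimately show ?thesis by simp
  qed
  finally show ?thesis
    using sum[of "{Suc Q..}"] sum[of "{Q}"] by (simp add: algebra_simps)
qed

theorem theorem4p1:
  fixes Q K0 K1 :: nat and pA pB qA qB :: real
  assumes "Q > 0" and "K0 > 0" and "K1 > 0"
    and "0 \<le> pA" and "pA \<le> 1" and "0 \<le> pB" and "pB \<le> 1"
    and "\<not> (pA = 0 \<and> pB = 0)" and "\<not> (pA = 1 \<and> pB = 1)"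
    and "qA = 1 - pA" and "qB = 1 - pB"
  shows
    "theta_M pA pB K0 K1 Q =
       (\<Sum>h=0..Q - 1. theta_M_score (Q + 1) h pA pB K0 K1 Q)
       + theta_M_score (Q + 1) Q pA pB K0 K1 Q
     \<and> (\<forall>h\<in>{0..Q - 1}.
          theta_M_score (Q + 1) h pA pB K0 K1 Q =
            (\<Sum>j=0..Q.
               real (t_A (Q + h) choose j) * real (t_B (Q + h) choose (Q - j))
               * theta_S pA pB K0 ^ j * (1 - theta_S pA pB K0) ^ (t_A (Q + h) - j)
               * (1 - theta_S pB pA K0) ^ (Q - j)
               * theta_S pB pA K0 ^ (t_B (Q + h) - (Q - j)))
            * theta_S pA pB K0 ^ J_A (Q + 1 + h)
            * (1 - theta_S pB pA K0) ^ (1 - J_A (Q + 1 + h)))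
     \<and> theta_M_score (Q + 1) Q pA pB K0 K1 Q =
         (\<Sum>j=0..Q.
            real (Q choose j) ^ 2 * (theta_S pA pB K0 * theta_S pB pA K0) ^ j
            * ((1 - theta_S pA pB K0) * (1 - theta_S pB pA K0)) ^ (Q - j))
         * theta_S pA pB K1 ^ J_A (2 * Q + 1)
         * (1 - theta_S pB pA K1) ^ (1 - J_A (2 * Q + 1))
     \<and> (\<forall>K>0.
          theta_M pA pB K K Q =
            measure_pmf.prob (indep_binomials Q (theta_S pA pB K) Q (1 - theta_S pB pA K))
              {(u, v). u + v \<ge> Q + 1}
            + measure_pmf.prob (indep_binomials Q (theta_S pA pB K) Q (1 - theta_S pB pA K))
                {(u, v). u + v = Q}
              * theta_S pA pB K)
     \<and> theta_M pA pB K0 K1 Q = theta_M qB qA K0 K1 Q"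
proof -
  have play: "playable pA pB"
    using assms by (simp add: playable_def)
  \<comment> \<open>After this substitution the sets are coin flips with success probability \<open>r K\<close>, whoever serves.\<close>
  define r where "r K = theta_S pA pB K" for K
  have S [simp]: "theta_S pA pB K = r K" "theta_S pB pA K = 1 - r K" for K
    by (simp_all add: r_def theta_S_swap[OF play])
  have complement: "1 - (1 - r K) = r K" for K by simp
  have score: "theta_M_score (Q + 1) h pA pB K0 K1 Q
      = real (Q + h choose h) * r K0 ^ Q * (1 - r K0) ^ h * r (if h = Q then K1 else K0)"
    if "h \<le> Q" for h
    using theta_M_score_eq[OF play that] by (simp only: r_def)

  have total: "theta_M pA pB K0 K1 Q = (\<Sum>h=0..Q - 1. theta_M_score (Q + 1) h pA pB K0 K1 Q)
      + theta_M_score (Q + 1) Q pA pB K0 K1 Q"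
  proof -
    have "{..Q} = insert Q {0..Q - 1}" "Q \<notin> {0..Q - 1}"
      using \<open>Q > 0\<close> by auto
    then show ?thesis
      unfolding theta_M_eq_sum by (simp add: add.commute)
  qed

  have early: "theta_M_score (Q + 1) h pA pB K0 K1 Q =
            (\<Sum>j=0..Q.
               real (t_A (Q + h) choose j) * real (t_B (Q + h) choose (Q - j))
               * theta_S pA pB K0 ^ j * (1 - theta_S pA pB K0) ^ (t_A (Q + h) - j)
               * (1 - theta_S pB pA K0) ^ (Q - j)
               * theta_S pB pA K0 ^ (t_B (Q + h) - (Q - j)))
            * theta_S pA pB K0 ^ J_A (Q + 1 + h)
            * (1 - theta_S pB pA K0) ^ (1 - J_A (Q + 1 + h))"
    if h: "h \<in> {0..Q - 1}" for h
  proof -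
    have sets: "t_A (Q + h) + t_B (Q + h) = Q + h"
      by (simp add: t_A_def t_B_def)
    \<comment> \<open>Whoever serves the last set, its factor is \<open>r K0\<close>.\<close>
    have last: "x ^ J_A g * x ^ (1 - J_A g) = x" for x :: real and g
      using mod_less_divisor[of 2 g] by (cases "g mod 2") (auto simp: J_A_def)
    have sum: "(\<Sum>j=0..Q. real (t_A (Q + h) choose j) * real (t_B (Q + h) choose (Q - j))
          * r K0 ^ j * (1 - r K0) ^ (t_A (Q + h) - j) * r K0 ^ (Q - j) * (1 - r K0) ^ (t_B (Q + h) - (Q - j)))
        = real (Q + h choose h) * r K0 ^ Q * (1 - r K0) ^ h"
      unfolding vandermonde_weighted sets using binomial_symmetric[of h "Q + h"] by simp
    have "h \<le> Q" "h \<noteq> Q"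
      using h \<open>Q > 0\<close> by auto
    with score[of h] have "theta_M_score (Q + 1) h pA pB K0 K1 Q
        = real (Q + h choose h) * r K0 ^ Q * (1 - r K0) ^ h * r K0"
      by simp
    then show ?thesis
      unfolding S complement sum by (simp only: mult.assoc last)
  qed

  have full: "theta_M_score (Q + 1) Q pA pB K0 K1 Q =
         (\<Sum>j=0..Q.
            real (Q choose j) ^ 2 * (theta_S pA pB K0 * theta_S pB pA K0) ^ j
            * ((1 - theta_S pA pB K0) * (1 - theta_S pB pA K0)) ^ (Q - j))
         * theta_S pA pB K1 ^ J_A (2 * Q + 1)
         * (1 - theta_S pB pA K1) ^ (1 - J_A (2 * Q + 1))"
  proof -
    have summand: "real (Q choose j) ^ 2 * (r K0 * (1 - r K0)) ^ j * ((1 - r K0) * r K0) ^ (Q - j)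
        = real ((Q choose j) ^ 2) * (r K0 ^ Q * (1 - r K0) ^ Q)" if "j \<le> Q" for j
    proof -
      have "(r K0 * (1 - r K0)) ^ j * (r K0 * (1 - r K0)) ^ (Q - j) = (r K0 * (1 - r K0)) ^ Q"
        using that by (metis le_add_diff_inverse power_add)
      then show ?thesis
        by (simp only: mult.commute[of "1 - r K0"] mult.assoc power_mult_distrib of_nat_power)
    qed
    have "(\<Sum>j=0..Q. real (Q choose j) ^ 2 * (r K0 * (1 - r K0)) ^ j * ((1 - r K0) * r K0) ^ (Q - j))
        = (\<Sum>j=0..Q. real ((Q choose j) ^ 2) * (r K0 ^ Q * (1 - r K0) ^ Q))"
      by (intro sum.cong refl summand) simp
    also have "\<dots> = real (\<Sum>j\<le>Q. (Q choose j) ^ 2) * (r K0 ^ Q * (1 - r K0) ^ Q)"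
      by (simp only: atLeast0AtMost sum_distrib_right of_nat_sum)
    also have "\<dots> = real (Q + Q choose Q) * (r K0 ^ Q * (1 - r K0) ^ Q)"
      by (simp only: choose_square_sum mult_2)
    finally have "(\<Sum>j=0..Q. real (Q choose j) ^ 2 * (r K0 * (1 - r K0)) ^ j * ((1 - r K0) * r K0) ^ (Q - j))
        = real (Q + Q choose Q) * (r K0 ^ Q * (1 - r K0) ^ Q)" .
    moreover have "J_A (2 * Q + 1) = 1"
      by (simp add: J_A_def)
    ultimately show ?thesis
      using score[of Q] by simp
  qed

  have binomials: "\<forall>K>0.
          theta_M pA pB K K Q =
            measure_pmf.prob (indep_binomials Q (theta_S pA pB K) Q (1 - theta_S pB pA K))
              {(u, v). u + v \<ge> Q + 1}
            + measure_pmf.prob (indep_binomials Q (theta_S pA pB K) Q (1 - theta_S pB pA K))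
                {(u, v). u + v = Q}
              * theta_S pA pB K"
    using theta_M_binomial[OF play] by simp

  have "theta_M pA pB K0 K1 Q = theta_M qB qA K0 K1 Q"
    unfolding theta_M_eq_sum \<open>qA = 1 - pA\<close> \<open>qB = 1 - pB\<close>
  proof (rule sum.cong)
    fix h assume "h \<in> {..Q}"
    then show "theta_M_score (Q + 1) h pA pB K0 K1 Q = theta_M_score (Q + 1) h (1 - pB) (1 - pA) K0 K1 Q"
      using theta_M_score_eq[OF play] theta_M_score_eq[OF playable_dual[OF play]]
      by (simp only: atMost_iff theta_S_dual[OF play])
  qed simp
  with total early full binomials show ?thesis by blast
qed

end
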